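(* Let $\Gamma$ be a numerical semigroup with multiplicity $m$, conductor $c$ and concentration $\mathbf{C}(\Gamma)=k$, and write $c=Lm+\rho$ with $2\leq\rho\leq m$. If the Eliahou number satisfies $E(\Gamma)<0$, then $$\frac{m}{k^2}<\frac{L+1}{L-1}.$$
   Context: $\mathbb{N}$ denotes the set of nonnegative integers. A numerical semigroup $\Gamma$ is an additive submonoid of $(\mathbb{N},+)$ whose elements have greatest common divisor $1$, so that $\mathbb{N}\setminus\Gamma$ is finite; it is assumed that $\Gamma\neq\mathbb{N}$. The multiplicity is $m=m(\Gamma)=\min(\Gamma\setminus\{0\})$, the conductor is $c=c(\Gamma)=\max(\mathbb{N}\setminus\Gamma)+1$, and the delta-invariant $\delta(\Gamma)$ is the number of elements of $\Gamma$ (including $0$) that are smaller than $c$. $G$ denotes the (finite, unique) minimal system of generators of $\Gamma$. The integer $L$ is $L=\lfloor (c-1)/m\rfloor$ and $\rho=c-Lm$, which satisfies $2\leq\rho\leq m$. The concentration of $\Gamma$ is $\mathbf{C}(\Gamma)=\max\{\operatorname{next}_\Gamma(s)-s : s\in\Gamma\setminus\{0\}\}$, where $\operatorname{next}_\Gamma(s)=\min\{x\in\Gamma : s<x\}$. Eliahou number: put $q=\lceil c/m\rceil$, $\nu=qm-c$, $J_q=\{c,c+1,\ldots,c+m-1\}$, $p_q=J_q\cap G$, $d_q=J_q\setminus p_q$, and $e_s=|\{g\in G : g<c\}|$. Then $E(\Gamma)=e_s\,\delta(\Gamma)-q\,|d_q|+\nu$. *)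

theory Defs
  imports Complex_Main "HOL.Hull"
begin

definition add_submonoid :: "nat set \<Rightarrow> bool" where
  "add_submonoid S \<longleftrightarrow> 0 \<in> S \<and> (\<forall>x\<in>S. \<forall>y\<in>S. x + y \<in> S)"

definition numerical_semigroup :: "nat set \<Rightarrow> bool" where
  "numerical_semigroup \<Gamma> \<longleftrightarrow> add_submonoid \<Gamma> \<and> Gcd \<Gamma> = 1"

definition ns_multiplicity :: "nat set \<Rightarrow> nat" where
  "ns_multiplicity \<Gamma> = (LEAST x. x \<in> \<Gamma> - {0})"

text \<open>
  The set of gaps \<open>- \<Gamma>\<close> is finite (lemma \<open>numerical_semigroup_cofinite\<close> below), and it is
  nonempty as soon as \<open>\<Gamma> \<noteq> UNIV\<close>.
\<close>

definition conductor :: "nat set \<Rightarrow> nat" where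
  "conductor \<Gamma> = Max (- \<Gamma>) + 1"

definition delta :: "nat set \<Rightarrow> nat" where
  "delta \<Gamma> = card {x \<in> \<Gamma>. x < conductor \<Gamma>}"

definition next_elem :: "nat set \<Rightarrow> nat \<Rightarrow> nat" where
  "next_elem \<Gamma> s = (LEAST x. x \<in> \<Gamma> \<and> s < x)"

text \<open>
  The set whose maximum is taken is finite and nonempty for every numerical semigroup, see
  \<open>concentration_well_defined\<close>.
\<close>

definition concentration :: "nat set \<Rightarrow> nat" where
  "concentration \<Gamma> = Max {next_elem \<Gamma> s - s |s. s \<in> \<Gamma> - {0}}"

definition is_minimal_generating_system :: "nat set \<Rightarrow> nat set \<Rightarrow> bool" where
  "is_minimal_generating_system \<Gamma> G \<longleftrightarrow>
     add_submonoid hull G = \<Gamma> \<and> (\<forall>H. H \<subset> G \<longrightarrow> add_submonoid hull H \<noteq> \<Gamma>)"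

text \<open>Existence and uniqueness are \<open>minimal_generators_unique\<close>.\<close>

definition minimal_generators :: "nat set \<Rightarrow> nat set" where
  "minimal_generators \<Gamma> = (THE G. is_minimal_generating_system \<Gamma> G)"

text \<open>The value can be negative, so it is computed in the integers.\<close>

definition eliahou_number :: "nat set \<Rightarrow> int" where
  "eliahou_number \<Gamma> =
    (let m = ns_multiplicity \<Gamma>;
         c = conductor \<Gamma>;
         G = minimal_generators \<Gamma>;
         q = \<lceil>real c / real m\<rceil>;
         \<nu> = q * int m - int c;
         J = {c..<c + m};
         p = J \<inter> G;
         d = J - p;
         e = card {g \<in> G. g < c}
     in int e * int (delta \<Gamma>) - q * int (card d) + \<nu>)"


subsection \<open>Well-definedness\<close>

lemma add_submonoid_mult:
  assumes "add_submonoid S" "x \<in> S"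
  shows "n * x \<in> S"
  using assms by (induction n) (auto simp: add_submonoid_def)

lemma numerical_semigroup_cofinite:
  assumes "numerical_semigroup \<Gamma>"
  shows "finite (- \<Gamma>)"
proof -
  have S: "add_submonoid \<Gamma>" and g: "Gcd \<Gamma> = 1"
    using assms by (auto simp: numerical_semigroup_def)
  have zero: "0 \<in> \<Gamma>" and add: "\<And>x y. x \<in> \<Gamma> \<Longrightarrow> y \<in> \<Gamma> \<Longrightarrow> x + y \<in> \<Gamma>"
    using S by (auto simp: add_submonoid_def)
  define P where "P d \<longleftrightarrow> d > 0 \<and> (\<exists>b\<in>\<Gamma>. b + d \<in> \<Gamma>)" for d
  obtain x0 where "x0 \<in> \<Gamma>" "x0 \<noteq> 0"
  proof (rule ccontr)
    assume "\<not> thesis"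
    then have "\<forall>x\<in>\<Gamma>. x = 0" using that by blast
    then have "Gcd \<Gamma> = 0" by (simp add: Gcd_0_iff subset_iff)
    then show False using g by simp
  qed
  then have "P x0" using zero by (auto simp: P_def intro!: bexI[of _ 0])
  define d where "d = (LEAST d. P d)"
  have Pd: "P d" and least: "\<And>e. P e \<Longrightarrow> d \<le> e"
    using \<open>P x0\<close> unfolding d_def by (auto intro: LeastI Least_le)
  then obtain b where b: "b \<in> \<Gamma>" "b + d \<in> \<Gamma>" "d > 0" by (auto simp: P_def)
  have "d dvd x" if "x \<in> \<Gamma>" for x
  proof (rule ccontr)
    assume "\<not> d dvd x"
    then have r: "x mod d > 0" by (simp add: dvd_eq_mod_eq_0)
    have eq: "(x div d) * (b + d) + x mod d = x + (x div d) * b"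
      by (metis add.assoc add.commute add_mult_distrib2 div_mult_mod_eq)
    have "P (x mod d)" unfolding P_def
      using r eq add[OF that add_submonoid_mult[OF S b(1)]] add_submonoid_mult[OF S b(2)]
      by metis
    then show False using least b(3) by (meson mod_less_divisor not_less)
  qed
  then have "d dvd Gcd \<Gamma>" by (rule Gcd_greatest)
  then have d: "d = 1" using g by simp
  have "n \<in> \<Gamma>" if "b * b \<le> n" for n
  proof (cases "b = 0")
    case True
    then show ?thesis using add_submonoid_mult[OF S b(2), of n] d by simp
  next
    case False
    have "n mod b < b" "b \<le> n div b"
      using False that by (simp_all add: less_eq_div_iff_mult_less_eq)
    then have "(n div b - n mod b) * b + (n mod b) * (b + d) = n"
      by (simp add: d diff_mult_distrib algebra_simps mult_le_mono)
    then show ?thesis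
      using add[OF add_submonoid_mult[OF S b(1)] add_submonoid_mult[OF S b(2)]] by metis
  qed
  then have "- \<Gamma> \<subseteq> {..<b * b}" by (auto simp: not_less[symmetric])
  then show ?thesis by (rule finite_subset) simp
qed

lemma concentration_well_defined:
  assumes "numerical_semigroup \<Gamma>"
  shows "finite {next_elem \<Gamma> s - s |s. s \<in> \<Gamma> - {0}}"
    and "{next_elem \<Gamma> s - s |s. s \<in> \<Gamma> - {0}} \<noteq> {}"
proof -
  have "finite (- \<Gamma>)" using numerical_semigroup_cofinite[OF assms] .
  then obtain N where N: "\<And>x. x \<notin> \<Gamma> \<Longrightarrow> x < N"
    by (metis ComplI finite_nat_set_iff_bounded)
  have "next_elem \<Gamma> s - s \<le> Suc N" for s
  proof -
    have "s + Suc N \<in> \<Gamma>" using N[of "s + Suc N"] by fastforce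
    then have "next_elem \<Gamma> s \<le> s + Suc N"
      unfolding next_elem_def by (intro Least_le) simp
    then show ?thesis by simp
  qed
  then have "{next_elem \<Gamma> s - s |s. s \<in> \<Gamma> - {0}} \<subseteq> {..Suc N}" by auto
  then show "finite {next_elem \<Gamma> s - s |s. s \<in> \<Gamma> - {0}}" by (rule finite_subset) simp
  have "Suc N \<in> \<Gamma> - {0}" using N[of "Suc N"] by fastforce
  then show "{next_elem \<Gamma> s - s |s. s \<in> \<Gamma> - {0}} \<noteq> {}" by blast
qed

definition irreducibles :: "nat set \<Rightarrow> nat set" where
  "irreducibles \<Gamma> = {x \<in> \<Gamma> - {0}. \<not> (\<exists>a\<in>\<Gamma> - {0}. \<exists>b\<in>\<Gamma> - {0}. x = a + b)}"

lemma add_submonoid_hull: "add_submonoid (add_submonoid hull A)"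
  by (rule hull_in) (auto simp: add_submonoid_def)

lemma hull_irreducibles:
  assumes "add_submonoid \<Gamma>"
  shows "add_submonoid hull (irreducibles \<Gamma>) = \<Gamma>"
proof
  show "add_submonoid hull (irreducibles \<Gamma>) \<subseteq> \<Gamma>"
    using assms by (intro hull_minimal) (auto simp: irreducibles_def)
  have H0: "0 \<in> add_submonoid hull (irreducibles \<Gamma>)"
    and Hadd: "\<And>a b. a \<in> add_submonoid hull (irreducibles \<Gamma>) \<Longrightarrow>
      b \<in> add_submonoid hull (irreducibles \<Gamma>) \<Longrightarrow>
      a + b \<in> add_submonoid hull (irreducibles \<Gamma>)"
    using add_submonoid_def[THEN iffD1, OF add_submonoid_hull] by blast+
  have "x \<in> \<Gamma> \<Longrightarrow> x \<in> add_submonoid hull (irreducibles \<Gamma>)" for x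
  proof (induction x rule: less_induct)
    case (less x)
    consider "x = 0" | "x \<in> irreducibles \<Gamma>"
      | a b where "a \<in> \<Gamma>" "b \<in> \<Gamma>" "a \<noteq> 0" "b \<noteq> 0" "x = a + b"
      using less.prems by (auto simp: irreducibles_def)
    then show ?case
    proof cases
      case 1
      then show ?thesis using H0 by simp
    next
      case 2
      then show ?thesis by (rule hull_inc)
    next
      case 3
      then show ?thesis using less.IH[of a] less.IH[of b] Hadd by simp
    qed
  qed
  then show "\<Gamma> \<subseteq> add_submonoid hull (irreducibles \<Gamma>)" by blast
qed

lemma irreducibles_subset_generators:
  assumes "add_submonoid hull A = \<Gamma>"
  shows "irreducibles \<Gamma> \<subseteq> A"
proof (rule ccontr)
  assume "\<not> irreducibles \<Gamma> \<subseteq> A"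
  then obtain x where x: "x \<in> irreducibles \<Gamma>" "x \<notin> A" by blast
  have S: "add_submonoid \<Gamma>" using add_submonoid_hull assms by blast
  have "add_submonoid (\<Gamma> - {x})"
    unfolding add_submonoid_def
  proof (intro conjI ballI)
    show "0 \<in> \<Gamma> - {x}" using S x by (auto simp: add_submonoid_def irreducibles_def)
  next
    fix a b assume ab: "a \<in> \<Gamma> - {x}" "b \<in> \<Gamma> - {x}"
    have "a + b \<noteq> x"
    proof (cases "a = 0 \<or> b = 0")
      case True
      then show ?thesis using ab by auto
    next
      case False
      then show ?thesis using ab x(1) by (auto simp: irreducibles_def)
    qed
    then show "a + b \<in> \<Gamma> - {x}" using ab S by (auto simp: add_submonoid_def)
  qed
  moreover have "A \<subseteq> \<Gamma> - {x}" using assms hull_subset[of A add_submonoid] x(2) by auto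
  ultimately have "add_submonoid hull A \<subseteq> \<Gamma> - {x}" by (intro hull_minimal)
  then show False using assms x(1) by (auto simp: irreducibles_def)
qed

lemma minimal_generators_unique:
  assumes "add_submonoid \<Gamma>"
  shows "is_minimal_generating_system \<Gamma> G \<longleftrightarrow> G = irreducibles \<Gamma>"
proof
  assume G: "is_minimal_generating_system \<Gamma> G"
  then have "irreducibles \<Gamma> \<subseteq> G"
    by (intro irreducibles_subset_generators) (simp add: is_minimal_generating_system_def)
  then show "G = irreducibles \<Gamma>"
    using G hull_irreducibles[OF assms] by (auto simp: is_minimal_generating_system_def)
next
  assume "G = irreducibles \<Gamma>"
  then show "is_minimal_generating_system \<Gamma> G"
    using hull_irreducibles[OF assms] irreducibles_subset_generators[of _ \<Gamma>]
    by (metis is_minimal_generating_system_def psubsetE)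
qed

lemma minimal_generators_eq:
  assumes "add_submonoid \<Gamma>"
  shows "minimal_generators \<Gamma> = irreducibles \<Gamma>"
  unfolding minimal_generators_def
  by (rule the_equality) (use minimal_generators_unique[OF assms] in blast)+

text \<open>
  The decomposition \<open>c = L m + \<rho>\<close> with \<open>2 \<le> \<rho> \<le> m\<close> exists, is unique, and is the one given by
  \<open>L = \<lfloor>(c - 1) / m\<rfloor>\<close> and \<open>\<rho> = c - L m\<close>.
\<close>

lemma conductor_decomposition:
  assumes "numerical_semigroup \<Gamma>" "\<Gamma> \<noteq> UNIV"
  defines "m \<equiv> ns_multiplicity \<Gamma>" and "c \<equiv> conductor \<Gamma>"
  shows "c = L * m + \<rho> \<and> 2 \<le> \<rho> \<and> \<rho> \<le> m \<longleftrightarrow> L = (c - 1) div m \<and> \<rho> = c - L * m"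
proof -
  have S: "add_submonoid \<Gamma>" using assms by (auto simp: numerical_semigroup_def)
  have fin: "finite (- \<Gamma>)" by (rule numerical_semigroup_cofinite) fact
  have gap: "c - 1 \<notin> \<Gamma>"
    using Max_in[OF fin] assms(2) by (auto simp: c_def conductor_def)
  have c: "c > 0" by (simp add: c_def conductor_def)
  have "infinite \<Gamma>" using fin by (metis finite_compl infinite_UNIV_nat)
  then have "\<exists>x. x \<in> \<Gamma> - {0}" by (metis finite.emptyI finite_Diff2 finite.insertI ex_in_conv)
  then have m: "m \<in> \<Gamma> - {0}"
    unfolding m_def ns_multiplicity_def by (metis (mono_tags, lifting) LeastI_ex)
  have r: "(c - 1) mod m \<noteq> 0"
  proof
    assume "(c - 1) mod m = 0"
    then have "c - 1 = ((c - 1) div m) * m" by (metis add.right_neutral div_mult_mod_eq)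
    then show False using gap m add_submonoid_mult[OF S, of m] by (metis DiffD1)
  qed
  have eq: "c = ((c - 1) div m) * m + ((c - 1) mod m + 1)"
    using c div_mult_mod_eq[of "c - 1" m] by linarith
  show ?thesis
  proof
    assume A: "c = L * m + \<rho> \<and> 2 \<le> \<rho> \<and> \<rho> \<le> m"
    then have "c - 1 = L * m + (\<rho> - 1)" "\<rho> - 1 < m" by linarith+
    then have "(c - 1) div m = L" by simp
    then show "L = (c - 1) div m \<and> \<rho> = c - L * m" using A by simp
  next
    assume A: "L = (c - 1) div m \<and> \<rho> = c - L * m"
    have Lm: "c = L * m + ((c - 1) mod m + 1)"
      using A eq by metis
    then have "\<rho> = (c - 1) mod m + 1" using A by linarith
    moreover have "(c - 1) mod m < m" using m by simp
    ultimately show "c = L * m + \<rho> \<and> 2 \<le> \<rho> \<and> \<rho> \<le> m" using Lm r by linarith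
  qed
qed

end

theory Submission
  imports Defs
begin

text \<open>
  Write \<open>e\<close> for the number of minimal generators below \<open>c\<close> and \<open>d\<close> for the number of decomposable
  elements of \<open>{c..<c + m}\<close>.  As \<open>q = L + 1\<close> and \<open>\<nu> = m - \<rho>\<close>, the Eliahou number is
  \<open>e \<delta> - (L + 1) d + (m - \<rho>)\<close> with \<open>m - \<rho> \<ge> 0\<close>, so its negativity forces \<open>e \<delta> < (L + 1) d\<close>.

  Concentration \<open>k\<close> means that each nonzero element of \<open>\<Gamma>\<close> has another one at most \<open>k\<close> further
  on, so an interval that starts at a nonzero element of \<open>\<Gamma>\<close> contains at least its length
  divided by \<open>k\<close> elements of \<open>\<Gamma>\<close> (\<open>length_le_concentration_mult_card\<close>).
  If \<open>L \<ge> 2\<close>, then \<open>2 m \<le> c\<close>.  All elements of \<open>\<Gamma>\<close> in \<open>{m..<2 * m}\<close> are generators, since a sum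
  of two nonzero elements is at least \<open>2 m\<close>; hence \<open>m \<le> k e\<close>.  The interval \<open>{m..<c}\<close> has length at
  least \<open>(L - 1) m\<close>; hence \<open>(L - 1) m \<le> k \<delta>\<close>.  Multiplying these and using \<open>d \<le> m\<close> gives
  \<open>(L - 1) m\<^sup>2 \<le> k\<^sup>2 e \<delta> < k\<^sup>2 (L + 1) m\<close>, and it remains to cancel \<open>m\<close>.

  It must also be shown that \<open>L \<ge> 2\<close>, for otherwise the right-hand side of the claim is not positive.
  If \<open>L \<le> 1\<close>, then \<open>c \<le> 2 m\<close>, and all elements of \<open>A = \<Gamma> \<inter> {m..<c}\<close> are generators.
  A decomposable element below \<open>c + m\<close> has both summands in \<open>A\<close>, and there are at most
  \<open>|A| (|A| + 1) / 2\<close> such sums.  Therefore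
  \<open>(L + 1) d \<le> 2 d \<le> |A| (|A| + 1) \<le> e \<delta>\<close>, and the Eliahou number is nonnegative.
\<close>

lemma twice_card_sumset_le:
  fixes A :: "'a::ab_semigroup_add set"
  assumes "finite A"
  shows "2 * card {a + b |a b. a \<in> A \<and> b \<in> A} \<le> card A * (card A + 1)"
  using assms
proof (induction A rule: finite_induct)
  case empty
  then show ?case by simp
next
  case (insert x A)
  let ?S = "{a + b |a b. a \<in> A \<and> b \<in> A}"
  have "finite ?S"
    using insert.hyps by (simp add: finite_image_set2)
  \<comment> \<open>By commutativity, the sums that involve \<open>x\<close> form a single translate.\<close>
  moreover have "{a + b |a b. a \<in> insert x A \<and> b \<in> insert x A} \<subseteq> ?S \<union> (+) x ` insert x A"
    using add.commute by blast
  ultimately have "card {a + b |a b. a \<in> insert x A \<and> b \<in> insert x A}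
      \<le> card (?S \<union> (+) x ` insert x A)"
    using insert.hyps by (intro card_mono) auto
  also have "\<dots> \<le> card ?S + card ((+) x ` insert x A)"
    by (rule card_Un_le)
  also have "\<dots> \<le> card ?S + (card A + 1)"
    using card_image_le[of "insert x A" "(+) x"] insert.hyps by simp
  finally show ?case
    using insert.IH insert.hyps by (simp add: algebra_simps)
qed

lemma ge_conductor_mem:
  assumes "numerical_semigroup \<Gamma>" "conductor \<Gamma> \<le> x"
  shows "x \<in> \<Gamma>"
proof (rule ccontr)
  assume "x \<notin> \<Gamma>"
  then have "x \<le> Max (- \<Gamma>)"
    using numerical_semigroup_cofinite[OF assms(1)] by (intro Max_ge) auto
  then show False
    using assms(2) by (simp add: conductor_def)
qed

lemma multiplicity_mem:
  assumes "numerical_semigroup \<Gamma>"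
  shows "ns_multiplicity \<Gamma> \<in> \<Gamma>" "0 < ns_multiplicity \<Gamma>"
proof -
  have "conductor \<Gamma> \<in> \<Gamma> - {0}"
    using ge_conductor_mem[OF assms] by (simp add: conductor_def)
  then have "ns_multiplicity \<Gamma> \<in> \<Gamma> - {0}"
    unfolding ns_multiplicity_def by (rule LeastI)
  then show "ns_multiplicity \<Gamma> \<in> \<Gamma>" "0 < ns_multiplicity \<Gamma>"
    by auto
qed

lemma multiplicity_le:
  assumes "x \<in> \<Gamma>" "x \<noteq> 0"
  shows "ns_multiplicity \<Gamma> \<le> x"
  unfolding ns_multiplicity_def using assms by (intro Least_le) simp

lemma irreducible_below_twice_multiplicity:
  assumes "x \<in> \<Gamma>" "x \<noteq> 0" "x < 2 * ns_multiplicity \<Gamma>"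
  shows "x \<in> irreducibles \<Gamma>"
proof -
  have "x \<noteq> a + b" if "a \<in> \<Gamma> - {0}" "b \<in> \<Gamma> - {0}" for a b
    using multiplicity_le[of a \<Gamma>] multiplicity_le[of b \<Gamma>] that assms(3) by auto
  then show ?thesis
    using assms by (auto simp: irreducibles_def)
qed

lemma ex_mem_within_concentration:
  assumes "numerical_semigroup \<Gamma>" "s \<in> \<Gamma>" "s \<noteq> 0"
  shows "\<exists>t\<in>\<Gamma>. s < t \<and> t \<le> s + concentration \<Gamma>"
proof -
  have "s + conductor \<Gamma> \<in> \<Gamma> \<and> s < s + conductor \<Gamma>"
    using ge_conductor_mem[OF assms(1)] by (simp add: conductor_def)
  then have "next_elem \<Gamma> s \<in> \<Gamma> \<and> s < next_elem \<Gamma> s"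
    unfolding next_elem_def by (rule LeastI)
  moreover have "next_elem \<Gamma> s - s \<le> concentration \<Gamma>"
    unfolding concentration_def
    using concentration_well_defined(1)[OF assms(1)] assms(2,3) by (intro Max_ge) auto
  ultimately show ?thesis
    by (intro bexI[of _ "next_elem \<Gamma> s"]) auto
qed

text \<open>
  The blocks of length \<open>k\<close> that start at the elements of \<open>\<Gamma>\<close> in the interval cover it: a point
  outside the block of the last element before it would leave a gap longer than \<open>k\<close>.
\<close>

lemma length_le_concentration_mult_card:
  assumes "numerical_semigroup \<Gamma>" "a \<in> \<Gamma>" "a \<noteq> 0"
  shows "b - a \<le> concentration \<Gamma> * card (\<Gamma> \<inter> {a..<b})"
proof -
  let ?k = "concentration \<Gamma>" and ?I = "\<Gamma> \<inter> {a..<b}"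
  have "{a..<b} \<subseteq> (\<Union>s\<in>?I. {s..<s + ?k})"
  proof
    fix x assume x: "x \<in> {a..<b}"
    define s where "s = Max (\<Gamma> \<inter> {a..x})"
    have "s \<in> \<Gamma> \<inter> {a..x}"
      unfolding s_def using x assms(2) by (intro Max_in) auto
    then have s: "s \<in> \<Gamma>" "a \<le> s" "s \<le> x" by auto
    have max: "t \<le> s" if "t \<in> \<Gamma>" "a \<le> t" "t \<le> x" for t
      unfolding s_def using that by (intro Max_ge) auto
    obtain t where t: "t \<in> \<Gamma>" "s < t" "t \<le> s + ?k"
      using ex_mem_within_concentration[OF assms(1) s(1)] s(2) assms(3) by auto
    have "x < s + ?k"
      using max[OF t(1)] t s by linarith
    then show "x \<in> (\<Union>s\<in>?I. {s..<s + ?k})"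
      using s x by auto
  qed
  then have "card {a..<b} \<le> card (\<Union>s\<in>?I. {s..<s + ?k})"
    by (intro card_mono) auto
  also have "\<dots> \<le> (\<Sum>s\<in>?I. card {s..<s + ?k})"
    by (intro card_UN_le) simp
  finally show ?thesis by (simp add: mult.commute)
qed

text \<open>
  Each summand is at least \<open>m\<close>, so the other one is below \<open>c\<close>.  All sums of two elements of
  \<open>\<Gamma> \<inter> {m..<c}\<close> are then counted by \<open>twice_card_sumset_le\<close>.
\<close>

lemma twice_card_decomposables_le:
  assumes "numerical_semigroup \<Gamma>"
  defines "m \<equiv> ns_multiplicity \<Gamma>" and "c \<equiv> conductor \<Gamma>"
  defines "A \<equiv> \<Gamma> \<inter> {m..<c}"
  shows "2 * card ({c..<c + m} - irreducibles \<Gamma>) \<le> card A * (card A + 1)"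
proof -
  have "{c..<c + m} - irreducibles \<Gamma> \<subseteq> {a + b |a b. a \<in> A \<and> b \<in> A}"
  proof
    fix x assume x: "x \<in> {c..<c + m} - irreducibles \<Gamma>"
    then have "x \<in> \<Gamma> - {0}"
      using ge_conductor_mem[OF assms(1), of x] by (auto simp: c_def conductor_def)
    then obtain a b where ab: "a \<in> \<Gamma> - {0}" "b \<in> \<Gamma> - {0}" "x = a + b"
      using x unfolding irreducibles_def by blast
    have "m \<le> a" "m \<le> b"
      using multiplicity_le ab by (auto simp: m_def)
    then show "x \<in> {a + b |a b. a \<in> A \<and> b \<in> A}"
      using ab x by (fastforce simp: A_def)
  qed
  moreover have "finite A" by (simp add: A_def)
  ultimately have "card ({c..<c + m} - irreducibles \<Gamma>) \<le> card {a + b |a b. a \<in> A \<and> b \<in> A}"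
    by (intro card_mono) (auto simp: finite_image_set2)
  then show ?thesis
    using twice_card_sumset_le[OF \<open>finite A\<close>] by linarith
qed

lemma eliahou_number_eq:
  assumes "numerical_semigroup \<Gamma>"
    and "m = ns_multiplicity \<Gamma>" "c = conductor \<Gamma>"
    and "c = L * m + \<rho>" "0 < \<rho>" "\<rho> \<le> m"
  shows "eliahou_number \<Gamma> =
    int (card {g \<in> irreducibles \<Gamma>. g < c}) * int (delta \<Gamma>)
      - (int L + 1) * int (card ({c..<c + m} - irreducibles \<Gamma>)) + (int m - int \<rho>)"
proof -
  have "\<lceil>real c / real m\<rceil> = int L + 1"
    by (rule ceiling_unique) (use assms(4-6) in \<open>auto simp: field_simps\<close>)
  moreover have "minimal_generators \<Gamma> = irreducibles \<Gamma>"
    using assms(1) by (intro minimal_generators_eq) (simp add: numerical_semigroup_def)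
  moreover have "{c..<c + m} - {c..<c + m} \<inter> irreducibles \<Gamma> = {c..<c + m} - irreducibles \<Gamma>"
    by blast
  moreover have "(int L + 1) * int m - int c = int m - int \<rho>"
    by (simp add: assms(4) algebra_simps)
  ultimately show ?thesis
    unfolding eliahou_number_def Let_def assms(2)[symmetric] assms(3)[symmetric]
    by simp
qed

theorem corollary4p5:
  fixes \<Gamma> :: "nat set" and m c k L \<rho> :: nat
  assumes "numerical_semigroup \<Gamma>" and "\<Gamma> \<noteq> UNIV"
    and "m = ns_multiplicity \<Gamma>"
    and "c = conductor \<Gamma>"
    and "concentration \<Gamma> = k"
    and "c = L * m + \<rho>" and "2 \<le> \<rho>" and "\<rho> \<le> m"
    and "eliahou_number \<Gamma> < 0"
  shows "real m / (real k)\<^sup>2 < (real L + 1) / (real L - 1)"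
proof -
  define A where "A = \<Gamma> \<inter> {m..<c}"
  define e where "e = card {g \<in> irreducibles \<Gamma>. g < c}"
  define d where "d = card ({c..<c + m} - irreducibles \<Gamma>)"
  have m: "m \<in> \<Gamma>" "m > 0"
    using multiplicity_mem[OF assms(1)] assms(3) by auto
  have "int e * int (delta \<Gamma>) < (int L + 1) * int d"
    using eliahou_number_eq[OF assms(1,3,4,6)] assms(7-9) by (simp add: e_def d_def)
  then have "int (e * delta \<Gamma>) < int ((L + 1) * d)"
    by (simp add: algebra_simps)
  then have neg: "e * delta \<Gamma> < (L + 1) * d"
    unfolding of_nat_less_iff .
  have generators: "card (\<Gamma> \<inter> {m..<b}) \<le> e" if "b \<le> c" "b \<le> 2 * m" for b
    unfolding e_def
    using irreducible_below_twice_multiplicity[of _ \<Gamma>] that assms(3) m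
    by (intro card_mono) auto
  have "card (insert 0 A) \<le> delta \<Gamma>"
    unfolding delta_def A_def
    using assms(1,4,6,7) by (intro card_mono) (auto simp: numerical_semigroup_def add_submonoid_def)
  then have delta: "card A + 1 \<le> delta \<Gamma>"
    using m by (simp add: A_def)
  have L: "2 \<le> L"
  proof (rule ccontr)
    assume "\<not> 2 \<le> L"
    then have L1: "L \<le> 1" by simp
    then have "L * m \<le> 1 * m" by (rule mult_le_mono1)
    then have "c \<le> 2 * m"
      using assms(6,8) by linarith
    have "(L + 1) * d \<le> 2 * d"
      using L1 by (intro mult_le_mono1) simp
    also have "\<dots> \<le> card A * (card A + 1)"
      using twice_card_decomposables_le[OF assms(1)] assms(3,4) by (simp add: d_def A_def)
    also have "\<dots> \<le> e * delta \<Gamma>"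
      using generators[of c] \<open>c \<le> 2 * m\<close> delta by (intro mult_le_mono) (simp_all add: A_def)
    finally show False using neg by simp
  qed
  have "2 * m \<le> L * m"
    using L by (rule mult_le_mono1)
  then have "2 * m \<le> c"
    using assms(6) by linarith
  have e_bound: "m \<le> k * e"
  proof -
    have "m \<le> k * card (\<Gamma> \<inter> {m..<2 * m})"
      using length_le_concentration_mult_card[OF assms(1) m(1), of "2 * m"] m assms(5) by simp
    also have "\<dots> \<le> k * e"
      using generators[of "2 * m"] \<open>2 * m \<le> c\<close> by simp
    finally show ?thesis .
  qed
  have "(L - 1) * m \<le> c - m"
    using assms(6) by (simp add: diff_mult_distrib)
  also have "\<dots> \<le> k * card A"
    using length_le_concentration_mult_card[OF assms(1) m(1), of c] m assms(5) by (simp add: A_def)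
  also have "\<dots> \<le> k * delta \<Gamma>"
    using delta by simp
  finally have delta_bound: "(L - 1) * m \<le> k * delta \<Gamma>" .
  have "k > 0"
    using e_bound m by (cases k) auto
  have "d \<le> m"
    using card_mono[of "{c..<c + m}" "{c..<c + m} - irreducibles \<Gamma>"] by (simp add: d_def)
  have "m * ((L - 1) * m) \<le> k * e * (k * delta \<Gamma>)"
    using e_bound delta_bound by (rule mult_le_mono)
  also have "\<dots> = k\<^sup>2 * (e * delta \<Gamma>)"
    by (simp add: power2_eq_square)
  also have "\<dots> < k\<^sup>2 * ((L + 1) * d)"
    using neg \<open>k > 0\<close> by simp
  also have "\<dots> \<le> k\<^sup>2 * ((L + 1) * m)"
    using \<open>d \<le> m\<close> by (intro mult_le_mono) simp_all
  finally have "m * ((L - 1) * m) < m * (k\<^sup>2 * (L + 1))"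
    by (simp only: ac_simps)
  then have "(L - 1) * m < k\<^sup>2 * (L + 1)"
    using m by simp
  then have "real ((L - 1) * m) < real (k\<^sup>2 * (L + 1))"
    by (simp only: of_nat_less_iff)
  then have "(real L - 1) * real m < (real k)\<^sup>2 * (real L + 1)"
    using L by (simp add: of_nat_diff algebra_simps)
  then show ?thesis
    using L \<open>k > 0\<close> by (simp add: field_simps)
qed

end
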